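(* Let $X$ be a set with $|X| > 2$ (possibly infinite), and let $\mathrm{Sym}(X)$ be the symmetric group on $X$. Then $\mathrm{Sym}(X)$ is indecomposable and $\mathrm{Sym}(X)$ contains a proper essential subgroup.
   Context: $\mathrm{Sym}(X)$ is the group of all bijections $X \to X$. A group is indecomposable if it is not the (internal) direct product of two nontrivial normal subgroups. A normal subgroup $E$ of a group $G$ is called an essential subgroup of $G$ if every nontrivial normal subgroup of $G$ intersects $E$ nontrivially; it is a proper essential subgroup if moreover $E \neq G$. *)

theory Defs
  imports "HOL-Algebra.Coset" "HOL-Algebra.Bij"
begin

text \<open>The group of all bijections of a set \<open>X\<close> is the library's \<open>BijGroup X\<close>, whose elements are
  the bijections \<open>X \<rightarrow> X\<close> that are \<open>undefined\<close> outside \<open>X\<close>, so that each bijection occurs once.\<close>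

definition internal_direct_product ::
    "('a, 'b) monoid_scheme \<Rightarrow> 'a set \<Rightarrow> 'a set \<Rightarrow> bool" where
  "internal_direct_product G A B \<longleftrightarrow>
     A \<lhd> G \<and> B \<lhd> G \<and> A \<inter> B = {\<one>\<^bsub>G\<^esub>} \<and> A <#>\<^bsub>G\<^esub> B = carrier G"

text \<open>The trivial group counts as indecomposable here.\<close>

definition indecomposable_group :: "('a, 'b) monoid_scheme \<Rightarrow> bool" where
  "indecomposable_group G \<longleftrightarrow>
     group G \<and>
     \<not> (\<exists>A B. A \<noteq> {\<one>\<^bsub>G\<^esub>} \<and> B \<noteq> {\<one>\<^bsub>G\<^esub>} \<and> internal_direct_product G A B)"

definition essential_subgroup :: "'a set \<Rightarrow> ('a, 'b) monoid_scheme \<Rightarrow> bool" where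
  "essential_subgroup E G \<longleftrightarrow>
     E \<lhd> G \<and> (\<forall>N. N \<lhd> G \<and> N \<noteq> {\<one>\<^bsub>G\<^esub>} \<longrightarrow> N \<inter> E \<noteq> {\<one>\<^bsub>G\<^esub>})"

definition proper_essential_subgroup :: "'a set \<Rightarrow> ('a, 'b) monoid_scheme \<Rightarrow> bool" where
  "proper_essential_subgroup E G \<longleftrightarrow> essential_subgroup E G \<and> E \<noteq> carrier G"

end

theory Submission
  imports Defs "HOL-Algebra.Elementary_Groups" "HOL-Combinatorics.Permutations"
begin

text \<open>The even permutations of finite support form a proper essential subgroup: if \<open>f\<close> moves \<open>a\<close>
  to \<open>b\<close> and \<open>c\<close> is a third point, then the commutator of \<open>f\<close> with the transposition \<open>(a c)\<close> is
  \<open>(b f(c)) (a c) \<noteq> 1\<close>, so every nontrivial normal subgroup contains a nontrivial product of two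
  transpositions.

  Suppose that \<open>Sym(X)\<close> is the product of nontrivial normal subgroups \<open>A\<close>, \<open>B\<close> with trivial
  intersection. They centralise each other, and a factor containing one transposition contains all
  of them, which forces the other factor to be central, hence trivial. So a transposition
  \<open>(x y)\<close> is \<open>a b\<close> with \<open>a \<in> A\<close>, \<open>b \<in> B\<close> both nontrivial. Both commute with \<open>(x y)\<close>, so one of
  them, say \<open>a\<close>, fixes \<open>x\<close> and \<open>y\<close>, while \<open>b\<close> swaps them. If \<open>a\<close> moves \<open>z\<close> to \<open>w\<close>,
  the conjugate of \<open>a\<close> by \<open>(y z)\<close> fixes \<open>x\<close> and moves \<open>y\<close> to \<open>w\<close>, so it does not commute
  with \<open>b\<close>.\<close>

section \<open>Transpositions in the group of bijections\<close>

text \<open>The disjunction expresses |X| > 2, since \<open>card\<close> is 0 on infinite sets. The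
  case \<open>x = y\<close> is allowed and later supplies a second point.\<close>

lemma ex_third_point:
  assumes "infinite X \<or> card X > 2"
  obtains z where "z \<in> X" "z \<noteq> x" "z \<noteq> y"
proof -
  have "\<not> X \<subseteq> {x, y}"
  proof
    assume sub: "X \<subseteq> {x, y}"
    then have "finite X" by (rule finite_subset) simp
    moreover have "card X \<le> card {x, y}" using sub by (intro card_mono) auto
    moreover have "card {x, y} \<le> 2" by (simp add: card_insert_if)
    ultimately show False using assms by linarith
  qed
  then show ?thesis using that by blast
qed

lemma carrier_BijGroup [simp]: "carrier (BijGroup X) = Bij X"
  by (simp add: BijGroup_def)

lemma one_BijGroup: "\<one>\<^bsub>BijGroup X\<^esub> = (\<lambda>x\<in>X. x)"
  by (simp add: BijGroup_def)

lemma mult_BijGroup_apply [simp]: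
  "f \<in> Bij X \<Longrightarrow> g \<in> Bij X \<Longrightarrow> x \<in> X \<Longrightarrow> (f \<otimes>\<^bsub>BijGroup X\<^esub> g) x = f (g x)"
  by (simp add: BijGroup_def compose_eq)

lemma mult_Bij [simp]: "f \<in> Bij X \<Longrightarrow> g \<in> Bij X \<Longrightarrow> f \<otimes>\<^bsub>BijGroup X\<^esub> g \<in> Bij X"
  by (simp add: BijGroup_def compose_Bij)

lemma Bij_mem [simp]: "f \<in> Bij X \<Longrightarrow> x \<in> X \<Longrightarrow> f x \<in> X"
  by (auto simp: Bij_def bij_betw_def)

lemma Bij_apply_eq_iff:
  "f \<in> Bij X \<Longrightarrow> x \<in> X \<Longrightarrow> y \<in> X \<Longrightarrow> f x = f y \<longleftrightarrow> x = y"
  by (rule inj_on_eq_iff) (simp_all add: Bij_def bij_betw_def)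

lemma Bij_eqI:
  "f \<in> Bij X \<Longrightarrow> g \<in> Bij X \<Longrightarrow> (\<And>x. x \<in> X \<Longrightarrow> f x = g x) \<Longrightarrow> f = g"
  by (auto simp: Bij_def intro: extensionalityI)

lemma Bij_neq_oneE:
  assumes "f \<in> Bij X" "f \<noteq> \<one>\<^bsub>BijGroup X\<^esub>"
  obtains x where "x \<in> X" "f x \<noteq> x"
proof -
  have "\<exists>x\<in>X. f x \<noteq> x"
    using assms Bij_eqI[OF assms(1) id_Bij] by (auto simp: one_BijGroup)
  then show ?thesis using that by blast
qed

text \<open>The restriction makes the map \<open>undefined\<close> outside \<open>X\<close>, as
  membership in \<open>Bij X\<close> demands.\<close>

definition Bij_transpose :: "'a set \<Rightarrow> 'a \<Rightarrow> 'a \<Rightarrow> 'a \<Rightarrow> 'a" where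
  "Bij_transpose X x y = restrict (transpose x y) X"

lemma Bij_transpose_apply [simp]: "z \<in> X \<Longrightarrow> Bij_transpose X x y z = transpose x y z"
  by (simp add: Bij_transpose_def)

lemma Bij_transpose_Bij [simp]: "x \<in> X \<Longrightarrow> y \<in> X \<Longrightarrow> Bij_transpose X x y \<in> Bij X"
  by (simp add: Bij_transpose_def Bij_def)

lemma Bij_transpose_square:
  assumes "x \<in> X" "y \<in> X"
  shows "Bij_transpose X x y \<otimes>\<^bsub>BijGroup X\<^esub> Bij_transpose X x y = \<one>\<^bsub>BijGroup X\<^esub>"
  by (rule Bij_eqI[of _ X]) (use assms in \<open>auto simp: one_BijGroup id_Bij transpose_def\<close>)

lemma inv_Bij_transpose:
  assumes "x \<in> X" "y \<in> X"
  shows "inv\<^bsub>BijGroup X\<^esub> Bij_transpose X x y = Bij_transpose X x y"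
  by (rule group.inv_equality[OF group_BijGroup]) (use assms in \<open>simp_all add: Bij_transpose_square\<close>)

lemma conjugate_Bij_transpose:
  assumes g: "g \<in> Bij X" and xy: "x \<in> X" "y \<in> X"
  shows "g \<otimes>\<^bsub>BijGroup X\<^esub> Bij_transpose X x y \<otimes>\<^bsub>BijGroup X\<^esub> inv\<^bsub>BijGroup X\<^esub> g
    = Bij_transpose X (g x) (g y)"
proof -
  interpret group "BijGroup X" by (rule group_BijGroup)
  have "g \<otimes>\<^bsub>BijGroup X\<^esub> Bij_transpose X x y
      = Bij_transpose X (g x) (g y) \<otimes>\<^bsub>BijGroup X\<^esub> g"
    by (rule Bij_eqI[of _ X]) (use assms in \<open>auto simp: transpose_def Bij_apply_eq_iff\<close>)
  then show ?thesis
    using assms by (simp add: inv_solve_right')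
qed

text \<open>Some \<open>g\<close> in \<open>Bij X\<close> carries the pair \<open>x\<close>,
  \<open>y\<close> to the pair \<open>u\<close>, \<open>v\<close>, and conjugation by it turns one
  transposition into the other.\<close>

lemma normal_contains_all_transpositions:
  assumes N: "N \<lhd> BijGroup X" and mem: "Bij_transpose X x y \<in> N"
    and xy: "x \<in> X" "y \<in> X" "x \<noteq> y" and uv: "u \<in> X" "v \<in> X" "u \<noteq> v"
  shows "Bij_transpose X u v \<in> N"
proof -
  interpret normal N "BijGroup X" by (rule N)
  define h where "h = Bij_transpose X x u"
  \<comment> \<open>After \<open>h\<close> has sent \<open>x\<close> to \<open>u\<close>, the second
    transposition brings \<open>h y\<close> to \<open>v\<close>. It leaves \<open>u\<close> in place
    because both \<open>h y\<close> and \<open>v\<close> differ from \<open>u\<close>.\<close>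
  define g where "g = Bij_transpose X (h y) v \<otimes>\<^bsub>BijGroup X\<^esub> h"
  have h: "h \<in> Bij X" "h x = u"
    using xy uv by (simp_all add: h_def)
  have "h y \<noteq> u"
    using h xy Bij_apply_eq_iff[of h X x y] by auto
  then have "g \<in> Bij X" "g x = u" "g y = v"
    using h xy uv by (simp_all add: g_def)
  then show ?thesis
    using inv_op_closed2[of g, OF _ mem] conjugate_Bij_transpose[of g X x y] xy by simp
qed

text \<open>If \<open>c\<close> moves \<open>p\<close>, take \<open>r\<close> different from
  \<open>p\<close> and \<open>c p\<close>. Commuting with the transposition of \<open>p\<close> and
  \<open>r\<close>, evaluated at \<open>p\<close>, gives \<open>c r = c p\<close>, against
  injectivity.\<close>

lemma centralizes_transpositions_imp_one:
  assumes X: "infinite X \<or> card X > 2" and c: "c \<in> Bij X"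
    and comm: "\<And>x y. x \<in> X \<Longrightarrow> y \<in> X \<Longrightarrow> x \<noteq> y \<Longrightarrow>
      c \<otimes>\<^bsub>BijGroup X\<^esub> Bij_transpose X x y = Bij_transpose X x y \<otimes>\<^bsub>BijGroup X\<^esub> c"
  shows "c = \<one>\<^bsub>BijGroup X\<^esub>"
proof (rule ccontr)
  assume "c \<noteq> \<one>\<^bsub>BijGroup X\<^esub>"
  then obtain p where p: "p \<in> X" "c p \<noteq> p"
    using c Bij_neq_oneE by blast
  obtain r where r: "r \<in> X" "r \<noteq> p" "r \<noteq> c p"
    using ex_third_point[OF X] by blast
  have "c (transpose p r p) = transpose p r (c p)"
    using arg_cong[OF comm[of p r], of "\<lambda>f. f p"] p r c by simp
  then have "c r = c p"
    using p r by simp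
  then show False
    using p r c Bij_apply_eq_iff[of c X r p] by simp
qed

section \<open>Indecomposability\<close>

text \<open>The final contradiction of the decomposition argument, stated for one factor so that it
  applies with the roles of the two factors exchanged.\<close>

lemma commuting_factor_fixing_imp_one:
  assumes A: "A \<lhd> BijGroup X" and B: "B \<subseteq> Bij X"
    and comm: "\<And>f g. f \<in> A \<Longrightarrow> g \<in> B \<Longrightarrow> f \<otimes>\<^bsub>BijGroup X\<^esub> g = g \<otimes>\<^bsub>BijGroup X\<^esub> f"
    and ab: "a \<in> A" "b \<in> B" "a \<otimes>\<^bsub>BijGroup X\<^esub> b = Bij_transpose X x y"
    and xy: "x \<in> X" "y \<in> X" "x \<noteq> y" and fixed: "a x = x" "a y = y"
  shows "a = \<one>\<^bsub>BijGroup X\<^esub>"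
proof (rule ccontr)
  interpret normal A "BijGroup X" by (rule A)
  have aB: "a \<in> Bij X" and bB: "b \<in> Bij X"
    using ab B subset by auto
  assume "a \<noteq> \<one>\<^bsub>BijGroup X\<^esub>"
  then obtain z where z: "z \<in> X" "a z \<noteq> z"
    using aB Bij_neq_oneE by blast
  have zxy: "z \<noteq> x" "z \<noteq> y" "a z \<noteq> y"
    using z fixed aB xy Bij_apply_eq_iff[of a X z y] by auto
  have "a (b x) = y"
    using ab(3) aB bB xy mult_BijGroup_apply[of a X b x] by simp
  then have bx: "b x = y"
    using fixed aB bB xy Bij_apply_eq_iff[of a X "b x" y] by simp
  define s where "s = Bij_transpose X y z"
  \<comment> \<open>As \<open>s\<close> is its own inverse, this is a conjugate of \<open>a\<close>.
    It sends \<open>y\<close> to \<open>a z\<close>, since \<open>s\<close> fixes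
    \<open>a z\<close>, which is neither \<open>y\<close> nor \<open>z\<close>. Commuting with
    \<open>b\<close> at \<open>x\<close> would then force \<open>a z = y\<close>.\<close>
  define a' where "a' = s \<otimes>\<^bsub>BijGroup X\<^esub> a \<otimes>\<^bsub>BijGroup X\<^esub> s"
  have s: "s \<in> Bij X" using xy z by (simp add: s_def)
  have a': "a' \<in> A" "a' \<in> Bij X"
    using inv_op_closed2[of s a] s ab(1) inv_Bij_transpose[of y X z] xy z aB
    by (simp_all add: a'_def s_def)
  have "a' (b x) = b (a' x)"
    using arg_cong[OF comm[OF a'(1) ab(2)], of "\<lambda>f. f x"] a' bB xy by simp
  moreover have "a' y = a z" "a' x = x"
    using s aB xy z zxy fixed by (simp_all add: a'_def) (simp_all add: s_def)
  ultimately show False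
    using bx zxy by simp
qed

text \<open>Evaluating at \<open>x\<close> shows that the transposition takes \<open>a x\<close> to
  \<open>a y\<close>. These differ, so \<open>a x\<close> is a moved point, hence \<open>x\<close>
  or \<open>y\<close>.\<close>

lemma fixes_pair_if_commutes_with_transpose:
  assumes a: "a \<in> Bij X" and xy: "x \<in> X" "y \<in> X" "x \<noteq> y"
    and comm: "a \<otimes>\<^bsub>BijGroup X\<^esub> Bij_transpose X x y = Bij_transpose X x y \<otimes>\<^bsub>BijGroup X\<^esub> a"
  shows "a x = x \<and> a y = y \<or> a x = y \<and> a y = x"
proof -
  have "a y = transpose x y (a x)"
    using arg_cong[OF comm, of "\<lambda>f. f x"] a xy by simp
  moreover have "a y \<noteq> a x"
    using a xy Bij_apply_eq_iff[of a X y x] by simp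
  ultimately show ?thesis
    by (auto simp: transpose_def split: if_splits)
qed

lemma transposition_notin_factor:
  assumes X: "infinite X \<or> card X > 2"
    and A: "A \<lhd> BijGroup X" and B: "B \<lhd> BijGroup X" and "B \<noteq> {\<one>\<^bsub>BijGroup X\<^esub>}"
    and comm: "\<And>f g. f \<in> A \<Longrightarrow> g \<in> B \<Longrightarrow> f \<otimes>\<^bsub>BijGroup X\<^esub> g = g \<otimes>\<^bsub>BijGroup X\<^esub> f"
    and xy: "x \<in> X" "y \<in> X" "x \<noteq> y"
  shows "Bij_transpose X x y \<notin> A"
proof
  interpret B: normal B "BijGroup X" by (rule B)
  assume t: "Bij_transpose X x y \<in> A"
  have "c = \<one>\<^bsub>BijGroup X\<^esub>" if c: "c \<in> B" for c
  proof (rule centralizes_transpositions_imp_one[OF X])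
    show "c \<in> Bij X" using c B.subset by auto
    show "c \<otimes>\<^bsub>BijGroup X\<^esub> Bij_transpose X u v = Bij_transpose X u v \<otimes>\<^bsub>BijGroup X\<^esub> c"
      if "u \<in> X" "v \<in> X" "u \<noteq> v" for u v
      by (rule comm[OF normal_contains_all_transpositions[OF A t xy that] c, symmetric])
  qed
  then have "B = {\<one>\<^bsub>BijGroup X\<^esub>}"
    using B.one_closed by (intro equalityI subsetI) simp_all
  then show False
    using assms(4) by simp
qed

theorem indecomposable_BijGroup:
  assumes X: "infinite X \<or> card X > 2"
  shows "indecomposable_group (BijGroup X)"
  unfolding indecomposable_group_def
proof (intro conjI notI)
  interpret group "BijGroup X" by (rule group_BijGroup)
  show "group (BijGroup X)" by (rule group_BijGroup)
  assume "\<exists>A B. A \<noteq> {\<one>\<^bsub>BijGroup X\<^esub>} \<and> B \<noteq> {\<one>\<^bsub>BijGroup X\<^esub>} \<and>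
    internal_direct_product (BijGroup X) A B"
  then obtain A B where nontriv: "A \<noteq> {\<one>\<^bsub>BijGroup X\<^esub>}" "B \<noteq> {\<one>\<^bsub>BijGroup X\<^esub>}"
    and A: "A \<lhd> BijGroup X" and B: "B \<lhd> BijGroup X"
    and int: "A \<inter> B = {\<one>\<^bsub>BijGroup X\<^esub>}" and prod: "A <#>\<^bsub>BijGroup X\<^esub> B = carrier (BijGroup X)"
    unfolding internal_direct_product_def by blast
  interpret A: normal A "BijGroup X" by (rule A)
  interpret B: normal B "BijGroup X" by (rule B)
  have comm: "f \<otimes>\<^bsub>BijGroup X\<^esub> g = g \<otimes>\<^bsub>BijGroup X\<^esub> f" if "f \<in> A" "g \<in> B" for f g
    using normal_imp_commuting[OF A B] int that by simp
  obtain x where x: "x \<in> X" using X by fastforce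
  obtain y where y: "y \<in> X" "y \<noteq> x" using ex_third_point[OF X, of x x] by blast
  define t where "t = Bij_transpose X x y"
  have "t \<in> carrier (BijGroup X)" using x y by (simp add: t_def)
  then obtain a b where ab: "a \<in> A" "b \<in> B" "t = a \<otimes>\<^bsub>BijGroup X\<^esub> b"
    unfolding prod[symmetric] set_mult_def by blast
  have aG: "a \<in> carrier (BijGroup X)" and bG: "b \<in> carrier (BijGroup X)"
    using ab A.subset B.subset by blast+
  then have aB: "a \<in> Bij X" and bB: "b \<in> Bij X" by simp_all
  \<comment> \<open>If one of \<open>a\<close>, \<open>b\<close> were trivial, the transposition
    \<open>t\<close> would lie in the other's factor.\<close>
  have ne: "a \<noteq> \<one>\<^bsub>BijGroup X\<^esub>" "b \<noteq> \<one>\<^bsub>BijGroup X\<^esub>"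
    using transposition_notin_factor[OF X A B nontriv(2) comm x y(1) y(2)[symmetric]]
      transposition_notin_factor[OF X B A nontriv(1) comm[symmetric] x y(1) y(2)[symmetric]]
      ab aG bG by (auto simp: t_def)
  have ba: "b \<otimes>\<^bsub>BijGroup X\<^esub> a = t" using comm[OF ab(1,2)] ab(3) by metis
  \<comment> \<open>Both sides equal \<open>a b a\<close>, because
    \<open>t = a b = b a\<close>.\<close>
  have "a \<otimes>\<^bsub>BijGroup X\<^esub> t = t \<otimes>\<^bsub>BijGroup X\<^esub> a"
    using aG bG ab(3) ba by (metis m_assoc)
  then consider "a x = x" "a y = y" | "a x = y" "a y = x"
    using fixes_pair_if_commutes_with_transpose[OF aB x y(1) y(2)[symmetric]] by (auto simp: t_def)
  then show False
  proof cases
    case 1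
    then show False
      using commuting_factor_fixing_imp_one[OF A _ comm ab(1,2) _ x y(1) y(2)[symmetric]]
        ab(3) ne(1) B.subset by (simp add: t_def)
  next
    case 2
    \<comment> \<open>Here \<open>a\<close> already performs the swap, so \<open>t = b a\<close>
      forces \<open>b\<close> to fix \<open>x\<close> and \<open>y\<close>, and the factors exchange
      roles.\<close>
    have "b (a x) = y" "b (a y) = x"
      using ba aB bB x y mult_BijGroup_apply[of b X a x] mult_BijGroup_apply[of b X a y]
      by (simp_all add: t_def)
    then have "b y = y" "b x = x" using 2 by simp_all
    then show False
      using commuting_factor_fixing_imp_one[OF B _ comm[symmetric] ab(2,1) _ x y(1) y(2)[symmetric]]
        ba ne(2) A.subset by (simp add: t_def)
  qed
qed

section \<open>The finitary alternating group\<close>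

text \<open>Turns an element of \<open>Bij X\<close> into a permutation of the whole type, the
  setting in which \<open>swapidseq\<close> and its parity theory live.\<close>

definition extend_id :: "'a set \<Rightarrow> ('a \<Rightarrow> 'a) \<Rightarrow> 'a \<Rightarrow> 'a" where
  "extend_id X f = (\<lambda>x. if x \<in> X then f x else x)"

lemma extend_id_one: "extend_id X \<one>\<^bsub>BijGroup X\<^esub> = id"
  by (auto simp: extend_id_def one_BijGroup)

lemma extend_id_mult:
  "f \<in> Bij X \<Longrightarrow> g \<in> Bij X \<Longrightarrow>
    extend_id X (f \<otimes>\<^bsub>BijGroup X\<^esub> g) = extend_id X f \<circ> extend_id X g"
  by (auto simp: extend_id_def)

lemma extend_id_inv:
  assumes "f \<in> Bij X"
  shows "extend_id X f \<circ> extend_id X (inv\<^bsub>BijGroup X\<^esub> f) = id"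
    and "extend_id X (inv\<^bsub>BijGroup X\<^esub> f) \<circ> extend_id X f = id"
proof -
  interpret group "BijGroup X" by (rule group_BijGroup)
  have f: "f \<in> carrier (BijGroup X)" using assms by simp
  then have f': "inv\<^bsub>BijGroup X\<^esub> f \<in> Bij X" using inv_closed[OF f] by simp
  show "extend_id X f \<circ> extend_id X (inv\<^bsub>BijGroup X\<^esub> f) = id"
    using extend_id_mult[OF assms f'] r_inv[OF f] by (simp add: extend_id_one)
  show "extend_id X (inv\<^bsub>BijGroup X\<^esub> f) \<circ> extend_id X f = id"
    using extend_id_mult[OF f' assms] l_inv[OF f] by (simp add: extend_id_one)
qed

lemma bij_extend_id: "f \<in> Bij X \<Longrightarrow> bij (extend_id X f)"
  using extend_id_inv o_bij by blast

lemma extend_id_inv_eq: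
  "f \<in> Bij X \<Longrightarrow> extend_id X (inv\<^bsub>BijGroup X\<^esub> f) = Hilbert_Choice.inv (extend_id X f)"
  using extend_id_inv inv_unique_comp by metis

lemma extend_id_Bij_transpose:
  "x \<in> X \<Longrightarrow> y \<in> X \<Longrightarrow> extend_id X (Bij_transpose X x y) = transpose x y"
  by (auto simp: extend_id_def transpose_def)

text \<open>Conjugating a product of transpositions by \<open>g\<close> conjugates each factor, and
  \<open>transpose a b\<close> becomes \<open>transpose (g a) (g b)\<close>; the length is
  unchanged.\<close>

lemma swapidseq_conjugate:
  assumes "swapidseq n p" "bij g"
  shows "swapidseq n (g \<circ> p \<circ> Hilbert_Choice.inv g)"
  using assms(1)
proof induction
  case id
  show ?case using assms(2) by (simp add: fun_eq_iff bij_is_surj surj_f_inv_f)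
next
  case (comp_Suc n p a b)
  have "g \<circ> (transpose a b \<circ> p) \<circ> Hilbert_Choice.inv g = transpose (g a) (g b) \<circ> (g \<circ> p \<circ> Hilbert_Choice.inv g)"
    using assms(2) by (auto simp: fun_eq_iff transpose_def bij_is_inj inj_eq)
  moreover have "g a \<noteq> g b"
    using comp_Suc assms(2) by (simp add: bij_is_inj inj_eq)
  ultimately show ?case
    using comp_Suc swapidseq.comp_Suc by metis
qed

text \<open>A product of \<open>n\<close> transpositions moves only finitely many points, so
  \<open>swapidseq\<close> carries the finite support as well as the parity. For finite
  \<open>X\<close> this is the usual alternating group.\<close>

definition finitary_alternating :: "'a set \<Rightarrow> ('a \<Rightarrow> 'a) set" where
  "finitary_alternating X = {f \<in> Bij X. \<exists>n. even n \<and> swapidseq n (extend_id X f)}"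

text \<open>Lengths of transposition products add under multiplication and are kept by inversion and
  conjugation, so evenness survives all three.\<close>

lemma normal_finitary_alternating: "finitary_alternating X \<lhd> BijGroup X"
proof -
  interpret group "BijGroup X" by (rule group_BijGroup)
  have inv_Bij: "inv\<^bsub>BijGroup X\<^esub> f \<in> Bij X" if "f \<in> Bij X" for f
    using inv_closed[of f] that by simp
  show ?thesis
  proof (rule normal_invI)
    show "subgroup (finitary_alternating X) (BijGroup X)"
    proof
      show "finitary_alternating X \<subseteq> carrier (BijGroup X)"
        by (auto simp: finitary_alternating_def)
      show "\<one>\<^bsub>BijGroup X\<^esub> \<in> finitary_alternating X"
        using one_closed by (auto simp: finitary_alternating_def extend_id_one intro!: exI[of _ 0])
    next
      fix f g assume "f \<in> finitary_alternating X" "g \<in> finitary_alternating X"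
      then obtain m n where fg: "f \<in> Bij X" "g \<in> Bij X" and "even m" "even n"
        and "swapidseq m (extend_id X f)" "swapidseq n (extend_id X g)"
        by (auto simp: finitary_alternating_def)
      then have "even (m + n)" "swapidseq (m + n) (extend_id X (f \<otimes>\<^bsub>BijGroup X\<^esub> g))"
        by (simp_all add: extend_id_mult swapidseq_comp_add)
      then show "f \<otimes>\<^bsub>BijGroup X\<^esub> g \<in> finitary_alternating X"
        unfolding finitary_alternating_def using fg mult_Bij by blast
    next
      fix f assume "f \<in> finitary_alternating X"
      then obtain n where f: "f \<in> Bij X" and "even n" "swapidseq n (extend_id X f)"
        by (auto simp: finitary_alternating_def)
      then have "even n" "swapidseq n (extend_id X (inv\<^bsub>BijGroup X\<^esub> f))"
        by (simp_all add: extend_id_inv_eq swapidseq_inverse)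
      then show "inv\<^bsub>BijGroup X\<^esub> f \<in> finitary_alternating X"
        unfolding finitary_alternating_def using inv_Bij[OF f] by blast
    qed
  next
    fix g f assume "g \<in> carrier (BijGroup X)" "f \<in> finitary_alternating X"
    then obtain n where g: "g \<in> Bij X" and f: "f \<in> Bij X" "even n" "swapidseq n (extend_id X f)"
      by (auto simp: finitary_alternating_def)
    let ?h = "g \<otimes>\<^bsub>BijGroup X\<^esub> f \<otimes>\<^bsub>BijGroup X\<^esub> inv\<^bsub>BijGroup X\<^esub> g"
    have "swapidseq n (extend_id X ?h)"
      using swapidseq_conjugate[OF f(3) bij_extend_id[OF g]] g f(1)
      by (simp add: extend_id_mult extend_id_inv_eq inv_Bij)
    moreover have "?h \<in> Bij X"
      using g f(1) inv_Bij by simp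
    ultimately show "?h \<in> finitary_alternating X"
      unfolding finitary_alternating_def using f(2) by blast
  qed
qed

text \<open>A permutation determines the parity of the length of its transposition products, and a
  transposition has one of length 1. This is what makes the subgroup proper.\<close>

lemma Bij_transpose_notin_finitary_alternating:
  assumes "x \<in> X" "y \<in> X" "x \<noteq> y"
  shows "Bij_transpose X x y \<notin> finitary_alternating X"
proof
  assume "Bij_transpose X x y \<in> finitary_alternating X"
  then obtain n where "even n" "swapidseq n (transpose x y)"
    using assms by (auto simp: finitary_alternating_def extend_id_Bij_transpose)
  moreover have "swapidseq 1 (transpose x y)"
    using swapidseq_swap[of x y] assms by simp
  ultimately show False
    using swapidseq_even_even by (metis odd_one)
qed

lemma transpositions_mult_in_finitary_alternating:
  assumes "u \<in> X" "v \<in> X" "u \<noteq> v" "x \<in> X" "y \<in> X" "x \<noteq> y"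
  shows "Bij_transpose X u v \<otimes>\<^bsub>BijGroup X\<^esub> Bij_transpose X x y \<in> finitary_alternating X"
proof -
  have "swapidseq 2 (transpose u v \<circ> transpose x y)"
    using swapidseq_comp_add[OF swapidseq_swap[of u v] swapidseq_swap[of x y]] assms
    by (simp add: numeral_2_eq_2)
  then show ?thesis
    unfolding finitary_alternating_def using assms
    by (auto simp: extend_id_mult extend_id_Bij_transpose intro!: exI[of _ 2])
qed

lemma normal_meets_finitary_alternating:
  assumes X: "infinite X \<or> card X > 2"
    and N: "N \<lhd> BijGroup X" and "N \<noteq> {\<one>\<^bsub>BijGroup X\<^esub>}"
  shows "N \<inter> finitary_alternating X \<noteq> {\<one>\<^bsub>BijGroup X\<^esub>}"
proof -
  interpret normal N "BijGroup X" by (rule N)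
  obtain f where f: "f \<in> N" "f \<noteq> \<one>\<^bsub>BijGroup X\<^esub>"
    using assms(3) subgroup.one_closed[OF is_subgroup] by blast
  have fG: "f \<in> carrier (BijGroup X)" using f subset by blast
  then have fB: "f \<in> Bij X" by simp
  obtain a where a: "a \<in> X" "f a \<noteq> a"
    by (rule Bij_neq_oneE[OF fB f(2)])
  obtain c where c: "c \<in> X" "c \<noteq> a" "c \<noteq> f a"
    using ex_third_point[OF X] by blast
  define t where "t = Bij_transpose X a c"
  have tG: "t \<in> carrier (BijGroup X)" and t_inv: "inv\<^bsub>BijGroup X\<^esub> t = t"
    using a c by (simp_all add: t_def inv_Bij_transpose)
  define k where "k = Bij_transpose X (f a) (f c) \<otimes>\<^bsub>BijGroup X\<^esub> t"
  \<comment> \<open>Reassociating the commutator exhibits it as \<open>f\<close> times a conjugate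
    of the inverse of \<open>f\<close>, both in \<open>N\<close>.\<close>
  have k: "k = f \<otimes>\<^bsub>BijGroup X\<^esub> (t \<otimes>\<^bsub>BijGroup X\<^esub> inv\<^bsub>BijGroup X\<^esub> f \<otimes>\<^bsub>BijGroup X\<^esub> t)"
    unfolding k_def conjugate_Bij_transpose[OF fB a(1) c(1), symmetric] t_def[symmetric]
    using fG tG by (simp add: m_assoc del: carrier_BijGroup)
  have "t \<otimes>\<^bsub>BijGroup X\<^esub> inv\<^bsub>BijGroup X\<^esub> f \<otimes>\<^bsub>BijGroup X\<^esub> t \<in> N"
    using inv_op_closed2[OF tG m_inv_closed[OF f(1)]] t_inv by simp
  then have "k \<in> N"
    using k f(1) by simp
  moreover have "f a \<noteq> f c"
    using fB a c Bij_apply_eq_iff[of f X a c] by simp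
  then have "k \<in> finitary_alternating X"
    unfolding k_def t_def using fB a(1) c
    by (intro transpositions_mult_in_finitary_alternating) auto
  moreover have "k \<noteq> \<one>\<^bsub>BijGroup X\<^esub>"
  proof
    assume "k = \<one>\<^bsub>BijGroup X\<^esub>"
    then have "k c = c" using c by (simp add: one_BijGroup)
    \<comment> \<open>The value is \<open>f a\<close> if \<open>a = f c\<close> and otherwise
      \<open>a\<close>, because \<open>a\<close> is not \<open>f a\<close>. Neither equals
      \<open>c\<close>, by the choice of \<open>c\<close>.\<close>
    moreover have "k c = transpose (f a) (f c) a"
      using fB a c by (simp add: k_def t_def)
    ultimately show False
      using a c by (auto simp: transpose_def split: if_splits)
  qed
  ultimately show ?thesis by blast
qed

theorem proper_essential_finitary_alternating:
  assumes X: "infinite X \<or> card X > 2"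
  shows "proper_essential_subgroup (finitary_alternating X) (BijGroup X)"
proof -
  obtain x where x: "x \<in> X" using X by fastforce
  obtain y where y: "y \<in> X" "y \<noteq> x" using ex_third_point[OF X, of x x] by blast
  have "Bij_transpose X x y \<in> carrier (BijGroup X) - finitary_alternating X"
    using Bij_transpose_notin_finitary_alternating[OF x y(1) y(2)[symmetric]] x y by simp
  then show ?thesis
    unfolding proper_essential_subgroup_def essential_subgroup_def
    using normal_finitary_alternating normal_meets_finitary_alternating[OF X] by blast
qed

theorem corollary2p4:
  fixes X :: "'a set"
  assumes "infinite X \<or> card X > 2"
  shows "indecomposable_group (BijGroup X) \<and>
         (\<exists>E. proper_essential_subgroup E (BijGroup X))"
  using indecomposable_BijGroup[OF assms] proper_essential_finitary_alternating[OF assms] by blast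

end
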